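(* Let $n\ge 3$ be an integer and let $\Gamma_{D_{2n}}$ be the non-commuting graph of the dihedral group $D_{2n}$ of order $2n$. Then its energy is $$E(\Gamma_{D_{2n}})=\begin{cases}(n-2)+\sqrt{5n^2-12n+4} & \text{if } n \text{ is even},\\ (n-1)+\sqrt{5n^{2}-6n+1} & \text{if } n \text{ is odd}.\end{cases}$$
   Context: For a finite non-abelian group $G$ with center $Z(G)$, the non-commuting graph $\Gamma_G=\Gamma(G)$ is the simple graph with vertex set $G\setminus Z(G)$ in which two vertices $x,y$ are adjacent if and only if $xy\ne yx$. The energy of a graph $\Gamma$ is $E(\Gamma)=\sum_i|\lambda_i|$, where the $\lambda_i$ are the eigenvalues (with multiplicity) of its adjacency matrix. *)

theory Defs
  imports
    "HOL-Algebra.Coset"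
    "Graph_Theory.Pair_Digraph"
    "Jordan_Normal_Form.Spectral_Radius"
begin

section \<open>Dihedral groups\<close>

text \<open>
  The pair \<open>(i, a)\<close> encodes \<open>r\<^sup>i s\<^sup>a\<close>, where \<open>r\<close> is the rotation of order \<open>n\<close>
  (with exponent taken modulo \<open>n\<close>), \<open>s\<close> is a reflection and \<open>s r = r\<^sup>-\<^sup>1 s\<close>. The group is indexed
  by \<open>n\<close>, half of its order: \<open>dihedral_group n\<close> is $D_{2n}$.
\<close>

definition dihedral_group :: "nat \<Rightarrow> (int \<times> bool) monoid" where
  "dihedral_group n =
    \<lparr>carrier = {0..<int n} \<times> UNIV,
     mult = (\<lambda>(i, a) (j, b). ((if a then i - j else i + j) mod int n, a \<noteq> b)),
     one = (0, False)\<rparr>"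

lemma group_dihedral_group:
  assumes "n > 0"
  shows "group (dihedral_group n)"
proof (rule groupI)
  fix x y z
  assume "x \<in> carrier (dihedral_group n)" "y \<in> carrier (dihedral_group n)"
    "z \<in> carrier (dihedral_group n)"
  show "x \<otimes>\<^bsub>dihedral_group n\<^esub> y \<otimes>\<^bsub>dihedral_group n\<^esub> z =
        x \<otimes>\<^bsub>dihedral_group n\<^esub> (y \<otimes>\<^bsub>dihedral_group n\<^esub> z)"
    by (cases x; cases y; cases z)
      (auto simp: dihedral_group_def mod_simps algebra_simps)
next
  fix x assume x: "x \<in> carrier (dihedral_group n)"
  obtain i a where xi: "x = (i, a)" by (cases x)
  let ?y = "(if a then i else (- i) mod int n, a)"
  have "?y \<in> carrier (dihedral_group n)"
    using x assms by (auto simp: dihedral_group_def xi)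
  moreover have "?y \<otimes>\<^bsub>dihedral_group n\<^esub> x = \<one>\<^bsub>dihedral_group n\<^esub>"
    by (auto simp: dihedral_group_def xi mod_simps)
  ultimately show "\<exists>y\<in>carrier (dihedral_group n). y \<otimes>\<^bsub>dihedral_group n\<^esub> x = \<one>\<^bsub>dihedral_group n\<^esub>"
    by blast
qed (use assms in \<open>auto simp: dihedral_group_def\<close>)

lemma order_dihedral_group: "Coset.order (dihedral_group n) = 2 * n"
  by (simp add: Coset.order_def dihedral_group_def card_cartesian_product)


section \<open>Non-commuting graphs\<close>

definition group_center :: "('a, 'b) monoid_scheme \<Rightarrow> 'a set" where
  "group_center G = {z \<in> carrier G. \<forall>x\<in>carrier G. z \<otimes>\<^bsub>G\<^esub> x = x \<otimes>\<^bsub>G\<^esub> z}"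

text \<open>Simple graphs are symmetric loop-free digraphs, as in the locale \<open>pair_graph\<close>.\<close>

definition non_commuting_graph :: "('a, 'b) monoid_scheme \<Rightarrow> 'a pair_pre_digraph" where
  "non_commuting_graph G =
    \<lparr>pverts = carrier G - group_center G,
     parcs = {(x, y). x \<in> carrier G - group_center G \<and> y \<in> carrier G - group_center G \<and>
                      x \<otimes>\<^bsub>G\<^esub> y \<noteq> y \<otimes>\<^bsub>G\<^esub> x}\<rparr>"

lemma pair_graph_non_commuting_graph:
  assumes "finite (carrier G)"
  shows "pair_graph (non_commuting_graph G)"
proof -
  let ?V = "carrier G - group_center G"
  have "finite (parcs (non_commuting_graph G))"
    by (rule finite_subset[of _ "?V \<times> ?V"]) (use assms in \<open>auto simp: non_commuting_graph_def\<close>)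
  then show ?thesis
    by unfold_locales
      (use assms in \<open>auto simp: non_commuting_graph_def arcs_ends_conv symmetric_def sym_def\<close>)
qed


section \<open>Graph energy\<close>

definition adjacency_mat :: "'a pair_pre_digraph \<Rightarrow> 'a list \<Rightarrow> complex mat" where
  "adjacency_mat G vs =
    mat (length vs) (length vs) (\<lambda>(i, j). if (vs ! i, vs ! j) \<in> parcs G then 1 else 0)"

text \<open>
  Eigenvalues are taken over the complex numbers and counted with algebraic multiplicity, so that
  the sum runs over the whole spectrum without appealing to the spectral theorem.
\<close>

definition mat_energy :: "complex mat \<Rightarrow> real" where
  "mat_energy A = (\<Sum>k\<in>spectrum A. real (Polynomial.order k (char_poly A)) * cmod k)"

text \<open>
  The adjacency matrix is formed with respect to an arbitrarily chosen enumeration of the vertices;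
  by \<open>graph_energy_eq\<close> below the choice is immaterial.
\<close>

definition graph_energy :: "'a pair_pre_digraph \<Rightarrow> real" where
  "graph_energy G = mat_energy (adjacency_mat G (SOME vs. distinct vs \<and> set vs = pverts G))"

lemma similar_adjacency_mat:
  assumes "distinct vs" "distinct ws" "set vs = set ws"
  shows "similar_mat (adjacency_mat G vs) (adjacency_mat G ws)"
proof -
  define n where "n = length vs"
  have n: "length vs = n" "length ws = n"
    using assms distinct_card[of vs] distinct_card[of ws] by (auto simp: n_def)
  define P where "P us us' = mat n n (\<lambda>(i, j). if us ! i = us' ! j then 1 else (0 :: complex))"
    for us us' :: "'a list"
  have entry: "(\<Sum>j<n. if us ! j = x then f j else 0) = f (THE j. j < n \<and> us ! j = x)"
    if us: "distinct us" "length us = n" "x \<in> set us" for us :: "'a list" and x and f :: "nat \<Rightarrow> complex"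
  proof -
    obtain m where m: "m < n" "us ! m = x"
      using us by (metis in_set_conv_nth)
    have eq: "us ! j = x \<longleftrightarrow> j = m" if "j < n" for j
      using that us m nth_eq_iff_index_eq by metis
    have the: "(THE j. j < n \<and> us ! j = x) = m"
      using m eq by (intro the_equality) auto
    have "(\<Sum>j<n. if us ! j = x then f j else 0) = (\<Sum>j<n. if j = m then f j else 0)"
      using eq by (intro sum.cong) auto
    then show ?thesis using m by (simp add: the)
  qed
  have idx: "(THE j. j < n \<and> us ! j = x) < n \<and> us ! (THE j. j < n \<and> us ! j = x) = x"
    if us: "distinct us" "length us = n" "x \<in> set us" for us :: "'a list" and x
  proof (rule theI')
    show "\<exists>!j. j < n \<and> us ! j = x"
      using us by (metis in_set_conv_nth nth_eq_iff_index_eq)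
  qed
  have mem: "us ! i \<in> set us'" if "set us = set us'" "length us = n" "i < n" for us us' :: "'a list" and i
    using that nth_mem by blast
  have PP: "P us us' * P us' us = 1\<^sub>m n"
    if us: "distinct us" "length us = n" "distinct us'" "length us' = n" "set us = set us'"
    for us us' :: "'a list"
  proof (rule eq_matI)
    fix i k assume ik: "i < dim_row (1\<^sub>m n :: complex mat)" "k < dim_col (1\<^sub>m n :: complex mat)"
    then have "(P us us' * P us' us) $$ (i, k) =
        (\<Sum>j<n. if us' ! j = us ! i then (if us' ! j = us ! k then 1 else 0) else 0)"
      by (auto simp: P_def scalar_prod_def lessThan_atLeast0 intro!: sum.cong)
    also have "\<dots> = (if us ! i = us ! k then 1 else 0)"
      using ik us by (subst entry) (auto simp: idx mem)
    also have "\<dots> = 1\<^sub>m n $$ (i, k)"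
      using ik us by (auto simp: nth_eq_iff_index_eq)
    finally show "(P us us' * P us' us) $$ (i, k) = 1\<^sub>m n $$ (i, k)" .
  qed (auto simp: P_def)
  have "adjacency_mat G vs * P vs ws = P vs ws * adjacency_mat G ws"
  proof (rule eq_matI)
    fix i k assume "i < dim_row (P vs ws * adjacency_mat G ws)"
      and "k < dim_col (P vs ws * adjacency_mat G ws)"
    then have ik: "i < n" "k < n" by (auto simp: P_def adjacency_mat_def n)
    have "(adjacency_mat G vs * P vs ws) $$ (i, k) =
        (\<Sum>j<n. if vs ! j = ws ! k then (if (vs ! i, vs ! j) \<in> parcs G then 1 else 0) else 0)"
      using ik by (auto simp: P_def adjacency_mat_def n scalar_prod_def lessThan_atLeast0 intro!: sum.cong)
    also have "\<dots> = (if (vs ! i, ws ! k) \<in> parcs G then 1 else 0)"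
      using ik assms n mem[of ws vs k] by (subst entry) (auto simp: idx)
    also have "\<dots> = (\<Sum>j<n. if ws ! j = vs ! i then (if (ws ! j, ws ! k) \<in> parcs G then 1 else 0) else 0)"
      using ik assms n mem[of vs ws i] by (subst entry) (auto simp: idx)
    also have "\<dots> = (P vs ws * adjacency_mat G ws) $$ (i, k)"
      using ik by (auto simp: P_def adjacency_mat_def n scalar_prod_def lessThan_atLeast0 intro!: sum.cong)
    finally show "(adjacency_mat G vs * P vs ws) $$ (i, k) = (P vs ws * adjacency_mat G ws) $$ (i, k)" .
  qed (auto simp: P_def adjacency_mat_def n)
  moreover have carr: "adjacency_mat G vs \<in> carrier_mat n n" "adjacency_mat G ws \<in> carrier_mat n n"
    "P vs ws \<in> carrier_mat n n" "P ws vs \<in> carrier_mat n n"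
    by (auto simp: P_def adjacency_mat_def n)
  ultimately have "P vs ws * adjacency_mat G ws * P ws vs = adjacency_mat G vs * (P vs ws * P ws vs)"
    using assoc_mult_mat[OF carr(1,3,4)] by simp
  then have "adjacency_mat G vs = P vs ws * adjacency_mat G ws * P ws vs"
    using PP[of vs ws] assms n carr by simp
  then show ?thesis
    using PP[of vs ws] PP[of ws vs] assms n carr by (intro similar_matI[of _ _ "P vs ws" "P ws vs" n]) auto
qed

lemma mat_energy_similar:
  assumes "similar_mat A B"
  shows "mat_energy A = mat_energy B"
proof -
  from similar_matD[OF assms] obtain n where AB: "A \<in> carrier_mat n n" "B \<in> carrier_mat n n"
    by auto
  have "spectrum A = spectrum B"
    using char_poly_similar[OF assms]
    by (auto simp: spectrum_def eigenvalue_root_char_poly[OF AB(1)] eigenvalue_root_char_poly[OF AB(2)])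
  then show ?thesis
    by (simp add: mat_energy_def char_poly_similar[OF assms])
qed

lemma graph_energy_eq:
  assumes "distinct vs" "set vs = pverts G"
  shows "graph_energy G = mat_energy (adjacency_mat G vs)"
proof -
  have "distinct (SOME vs. distinct vs \<and> set vs = pverts G) \<and>
        set (SOME vs. distinct vs \<and> set vs = pverts G) = pverts G"
    by (rule someI[of _ vs]) (use assms in simp)
  then show ?thesis
    unfolding graph_energy_def
    by (intro mat_energy_similar similar_adjacency_mat) (use assms in auto)
qed

end

theory Submission
  imports Defs
begin

text \<open>
  Let \<open>c\<close> be the order of the centre, 2 for even \<open>n\<close> and 1 for odd \<open>n\<close>. Non-commutation of
  non-central elements is the complement of an equivalence relation: the \<open>n - c\<close> rotations form
  one class, and the reflections split into \<open>q = n / c\<close> classes of size \<open>c\<close>. So the graph is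
  complete multipartite, and its adjacency matrix has rank at most \<open>q + 1\<close>. Sylvester's determinant
  identity, applied first to the incidence matrix of the classes and then to a rank-one update of a
  diagonal matrix, gives for parts of sizes \<open>d\<^sub>l\<close>
  \[\chi(x) = x^N \prod_l \frac{x + d_l}{x} \Bigl(1 - \sum_l \frac{d_l}{x + d_l}\Bigr).\]
  For one part of size \<open>m\<close> and \<open>q\<close> parts of size \<open>c\<close> the nonzero eigenvalues are therefore \<open>-c\<close>, with
  multiplicity \<open>q - 1\<close>, and the two roots, of opposite sign, of \<open>x\<^sup>2 - (q - 1) c x - q c m\<close>.
\<close>

section \<open>The characteristic polynomial of a complete multipartite graph\<close>

text \<open>Multiplying \<open>?M\<close> by the unitriangular \<open>?U\<close> on either side
  clears the upper right block. The diagonal blocks become \<open>1 + X * Y\<close> and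
  \<open>1\<close> in one order, \<open>1\<close> and \<open>1 + Y * X\<close> in the other, and
  determinants do not see the order.\<close>

lemma det_one_plus_mult_commute:
  fixes X Y :: "'a :: idom mat"
  assumes X: "X \<in> carrier_mat n k" and Y: "Y \<in> carrier_mat k n"
  shows "det (1\<^sub>m n + X * Y) = det (1\<^sub>m k + Y * X)"
proof -
  let ?M = "four_block_mat (1\<^sub>m n) (- X) Y (1\<^sub>m k)"
  let ?U = "four_block_mat (1\<^sub>m n) X (0\<^sub>m k n) (1\<^sub>m k)"
  have M: "?M \<in> carrier_mat (n + k) (n + k)" and U: "?U \<in> carrier_mat (n + k) (n + k)"
    by auto
  have XY: "X * Y \<in> carrier_mat n n" and YX: "Y * X \<in> carrier_mat k k"
    using X Y by auto
  have "?U * ?M = four_block_mat (1\<^sub>m n + X * Y) (0\<^sub>m n k) Y (1\<^sub>m k)"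
    by (subst mult_four_block_mat[of _ n n _ k _ k _ _ n _ k]) (use X Y in auto)
  then have "det ?U * det ?M = det (1\<^sub>m n + X * Y)"
    using det_four_block_mat_upper_right_zero[of "1\<^sub>m n + X * Y" n "0\<^sub>m n k" k Y "1\<^sub>m k"] XY Y
    by (simp flip: det_mult[OF U M])
  moreover have "?M * ?U = four_block_mat (1\<^sub>m n) (0\<^sub>m n k) Y (1\<^sub>m k + Y * X)"
    by (subst mult_four_block_mat[of _ n n _ k _ k _ _ n _ k])
      (use X Y in \<open>auto intro!: arg_cong3[of _ _ _ _ _ _ "four_block_mat _"] comm_add_mat\<close>)
  then have "det ?M * det ?U = det (1\<^sub>m k + Y * X)"
    using det_four_block_mat_upper_right_zero[of "1\<^sub>m n" n "0\<^sub>m n k" k Y "1\<^sub>m k + Y * X"] YX Y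
    by (simp flip: det_mult[OF M U])
  ultimately show ?thesis by (simp add: mult.commute)
qed

lemma poly_char_poly_multipartite:
  fixes G :: "'a pair_pre_digraph" and f :: "'a \<Rightarrow> nat" and x :: complex
  assumes vs: "distinct vs"
    and colour: "\<And>v. v \<in> set vs \<Longrightarrow> f v < k"
    and adj: "\<And>u v. u \<in> set vs \<Longrightarrow> v \<in> set vs \<Longrightarrow> (u, v) \<in> parcs G \<longleftrightarrow> f u \<noteq> f v"
    and d: "\<And>l. d l = of_nat (card {v \<in> set vs. f v = l})"
    and x: "x \<noteq> 0" "\<And>l. l < k \<Longrightarrow> x + d l \<noteq> 0"
  shows "poly (char_poly (adjacency_mat G vs)) x =
    x ^ length vs * (\<Prod>l<k. (x + d l) / x) * (1 - (\<Sum>l<k. d l / (x + d l)))"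
proof -
  let ?N = "length vs" and ?A = "adjacency_mat G vs"
  \<comment> \<open>\<open>W\<close> is the vertex-class incidence matrix. \<open>C\<close> is
    chosen so that \<open>W * C\<close> is the adjacency matrix divided by \<open>-x\<close>: row
    \<open>i\<close> of the product is the row of \<open>C\<close> that belongs to the class of
    vertex \<open>i\<close>.\<close>
  define W where "W = mat ?N k (\<lambda>(i, l). if f (vs ! i) = l then 1 else (0 :: complex))"
  define C where "C = mat k ?N (\<lambda>(l, j). if l \<noteq> f (vs ! j) then - 1 / x else 0)"
  define U where "U = mat k 1 (\<lambda>_. 1 :: complex)"
  define V where "V = mat 1 k (\<lambda>(_, l). - d l / (x + d l))"
  define D where "D = mat k k (\<lambda>(l, l'). if l = l' then (x + d l) / x else 0)"
  have carr: "?A \<in> carrier_mat ?N ?N" "W \<in> carrier_mat ?N k" "C \<in> carrier_mat k ?N"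
    "U \<in> carrier_mat k 1" "V \<in> carrier_mat 1 k" "D \<in> carrier_mat k k"
    by (auto simp: adjacency_mat_def W_def C_def U_def V_def D_def)
  have fibre: "(\<Sum>j<?N. if f (vs ! j) = l then c else 0) = d l * c" for l and c :: complex
  proof -
    have "(\<Sum>j<?N. if f (vs ! j) = l then c else 0) = (\<Sum>v\<in>set vs. if f v = l then c else 0)"
      by (rule sum.reindex_bij_betw) (use bij_betw_nth[OF vs] in \<open>auto simp: atLeast0LessThan\<close>)
    also have "\<dots> = d l * c"
      by (simp add: d sum.If_cases Int_def)
    finally show ?thesis .
  qed
  have WC: "(W * C) $$ (i, j) = (if f (vs ! i) \<noteq> f (vs ! j) then - 1 / x else 0)"
    if "i < ?N" "j < ?N" for i j
  proof -
    have "(W * C) $$ (i, j) =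
        (\<Sum>l<k. if l = f (vs ! i) then (if l \<noteq> f (vs ! j) then - 1 / x else 0) else 0)"
      using that by (auto simp: W_def C_def scalar_prod_def lessThan_atLeast0
          simp del: sum.delta sum.delta' intro!: sum.cong)
    then show ?thesis using that colour by simp
  qed
  have "poly (char_poly ?A) x = det (- char_matrix ?A x)"
    by (rule char_poly_matrix[OF carr(1)])
  also have "- char_matrix ?A x = x \<cdot>\<^sub>m (1\<^sub>m ?N + W * C)"
  proof (rule eq_matI)
    fix i j assume "i < dim_row (x \<cdot>\<^sub>m (1\<^sub>m ?N + W * C))" "j < dim_col (x \<cdot>\<^sub>m (1\<^sub>m ?N + W * C))"
    then have ij: "i < ?N" "j < ?N" using carr by auto
    then show "(- char_matrix ?A x) $$ (i, j) = (x \<cdot>\<^sub>m (1\<^sub>m ?N + W * C)) $$ (i, j)"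
      using carr x(1) WC[OF ij] adj[of "vs ! i" "vs ! j"]
      by (simp add: char_matrix_def adjacency_mat_def)
  qed (use carr in \<open>auto simp: char_matrix_def\<close>)
  also have "det \<dots> = x ^ ?N * det (1\<^sub>m k + C * W)"
    using carr det_one_plus_mult_commute[of W ?N k C] by simp
  \<comment> \<open>Off the diagonal, \<open>C * W\<close> has the entries
    \<open>- d l' / x\<close>, independent of the row. Hence \<open>1 + C * W\<close> is
    \<open>D\<close> plus a matrix with constant columns, and pulling \<open>D\<close> out on the
    right turns \<open>- d l' / x\<close> into the entry \<open>- d l' / (x + d l')\<close> of
    \<open>V\<close>.\<close>
  also have "1\<^sub>m k + C * W = (1\<^sub>m k + U * V) * D"
  proof (rule eq_matI)
    fix l l' assume "l < dim_row ((1\<^sub>m k + U * V) * D)" "l' < dim_col ((1\<^sub>m k + U * V) * D)"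
    then have l: "l < k" "l' < k" using carr by auto
    have "(C * W) $$ (l, l') = (\<Sum>j<?N. if f (vs ! j) = l' then (if l \<noteq> l' then - 1 / x else 0) else 0)"
      using l by (auto simp: W_def C_def scalar_prod_def lessThan_atLeast0 intro!: sum.cong)
    then have CW: "(C * W) $$ (l, l') = (if l \<noteq> l' then - d l' / x else 0)"
      by (simp add: fibre)
    have "((1\<^sub>m k + U * V) * D) $$ (l, l') =
        (\<Sum>m<k. if m = l' then ((if l = m then 1 else 0) - d m / (x + d m)) * ((x + d m) / x) else 0)"
      using l by (auto simp: U_def V_def D_def scalar_prod_def lessThan_atLeast0
          simp del: sum.delta sum.delta' intro!: sum.cong)
    also have "\<dots> = ((if l = l' then 1 else 0) - d l' / (x + d l')) * ((x + d l') / x)"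
      using l by simp
    also have "\<dots> = (1\<^sub>m k + C * W) $$ (l, l')"
      using l carr x(1) x(2)[OF l(2)] CW by (auto simp: divide_simps)
    finally show "(1\<^sub>m k + C * W) $$ (l, l') = ((1\<^sub>m k + U * V) * D) $$ (l, l')" ..
  qed (use carr in auto)
  also have "det \<dots> = det (1\<^sub>m k + U * V) * det D"
    by (rule det_mult) (use carr in auto)
  also have "det (1\<^sub>m k + U * V) = det (1\<^sub>m 1 + V * U)"
    by (rule det_one_plus_mult_commute) (use carr in auto)
  also have "\<dots> = 1 - (\<Sum>l<k. d l / (x + d l))"
    using carr by (subst det_single)
      (auto simp: U_def V_def scalar_prod_def lessThan_atLeast0 sum_negf)
  also have "det D = (\<Prod>l<k. (x + d l) / x)"
    by (subst det_upper_triangular[of _ k])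
      (auto simp: D_def prod_list_diag_prod lessThan_atLeast0)
  finally show ?thesis by (simp add: mult_ac)
qed

section \<open>From a factored characteristic polynomial to the energy\<close>

text \<open>A nonzero difference would have infinitely many roots. This lifts the determinant
  formula, valid only where no denominator vanishes, to an identity of polynomials.\<close>

lemma poly_eqI_cofinite:
  fixes p q :: "'a :: {idom, ring_char_0} poly"
  assumes "finite S" and "\<And>x. x \<notin> S \<Longrightarrow> poly p x = poly q x"
  shows "p = q"
proof (rule ccontr)
  assume "p \<noteq> q"
  then have "finite {x. poly (p - q) x = 0}"
    by (intro poly_roots_finite) auto
  moreover have "UNIV \<subseteq> S \<union> {x. poly (p - q) x = 0}"
    using assms(2) by auto
  ultimately show False
    using assms(1) infinite_UNIV_char_0 by (metis finite_Un finite_subset)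
qed

lemma sum_count_list:
  fixes f :: "'a \<Rightarrow> real"
  assumes "finite S" "set xs \<subseteq> S"
  shows "(\<Sum>x\<in>S. real (count_list xs x) * f x) = (\<Sum>x\<leftarrow>xs. f x)"
  using assms(2)
proof (induction xs)
  case (Cons a xs)
  have "(\<Sum>x\<in>S. real (count_list (a # xs) x) * f x) =
      (\<Sum>x\<in>S. (if x = a then f x else 0) + real (count_list xs x) * f x)"
    by (intro sum.cong) (auto simp: algebra_simps)
  then show ?case using Cons assms(1) by (simp add: sum.distrib)
qed simp

text \<open>The order of a root is the number of its occurrences in \<open>as\<close>, so weighting
  the spectrum by multiplicity amounts to summing over the list.\<close>

lemma mat_energy_factored:
  assumes A: "A \<in> carrier_mat n n" and fac: "char_poly A = (\<Prod>a\<leftarrow>as. [:- a, 1:])"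
  shows "mat_energy A = (\<Sum>a\<leftarrow>as. cmod a)"
proof -
  have order_eq: "Polynomial.order k (\<Prod>a\<leftarrow>as. [:- a, 1:]) = count_list as k" for k
  proof (induction as)
    case (Cons a as)
    have "Polynomial.order k [:- a, 1:] = (if a = k then 1 else 0)"
      using order_linear_power[of k "- a" 1] by auto
    moreover have "Polynomial.order k ([:- a, 1:] * (\<Prod>a\<leftarrow>as. [:- a, 1:])) =
        Polynomial.order k [:- a, 1:] + Polynomial.order k (\<Prod>a\<leftarrow>as. [:- a, 1:])"
      by (rule order_mult) (auto simp: prod_list_zero_iff simp del: mult_pCons_left)
    ultimately show ?case using Cons by (auto simp del: mult_pCons_left)
  qed simp
  have "spectrum A = set as"
    by (auto simp: spectrum_def eigenvalue_root_char_poly[OF A] fac poly_prod_list_zero_iff)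
  then show ?thesis
    by (simp add: mat_energy_def fac order_eq sum_count_list)
qed

section \<open>The energy for one part of size \<open>m\<close> and \<open>q\<close> parts of size
  \<open>c\<close>\<close>

text \<open>The eigenvalue \<open>-c\<close> contributes \<open>(q - 1) * c\<close>. The other two
  nonzero eigenvalues have opposite signs, so their absolute values add up to their distance, the
  square root of the discriminant.\<close>

lemma graph_energy_multipartite:
  fixes G :: "'a pair_pre_digraph" and f :: "'a \<Rightarrow> nat" and m c q :: nat
  assumes fin: "finite (pverts G)"
    and colour: "\<And>v. v \<in> pverts G \<Longrightarrow> f v \<le> q"
    and adj: "\<And>u v. u \<in> pverts G \<Longrightarrow> v \<in> pverts G \<Longrightarrow> (u, v) \<in> parcs G \<longleftrightarrow> f u \<noteq> f v"
    and part0: "card {v \<in> pverts G. f v = 0} = m"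
    and parts: "\<And>l. l < q \<Longrightarrow> card {v \<in> pverts G. f v = Suc l} = c"
    and pos: "m > 0" "c > 0" "q > 0"
  shows "graph_energy G =
    (real q - 1) * real c + sqrt (((real q - 1) * real c)\<^sup>2 + 4 * real q * real c * real m)"
proof -
  obtain vs where vs: "distinct vs" "set vs = pverts G"
    using fin finite_distinct_list by metis
  let ?A = "adjacency_mat G vs"
  \<comment> \<open>\<open>t\<close> is the sum and \<open>s\<close> the distance of the two roots
    of the quadratic factor.\<close>
  define t where "t = (real q - 1) * real c"
  define s where "s = sqrt (t\<^sup>2 + 4 * real q * real c * real m)"
  have "(\<Sum>l<Suc q. \<Sum>v | v \<in> set vs \<and> f v = l. 1 :: nat) = (\<Sum>v\<in>set vs. 1)"
    by (rule sum.group) (use colour vs fin in \<open>auto simp: less_Suc_eq_le\<close>)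
  then have "length vs = (\<Sum>l<Suc q. card {v \<in> set vs. f v = l})"
    by (simp add: distinct_card[OF vs(1)] del: sum.lessThan_Suc)
  then have len: "length vs = m + q * c"
    using part0 parts vs by (simp add: sum.lessThan_Suc_shift del: sum.lessThan_Suc)
  \<comment> \<open>The multiplicity of the root 0. The subtraction does not truncate, since all
    \<open>q + 1\<close> parts are nonempty.\<close>
  define e where "e = m + q * c - (q + 1)"
  have "q * 1 \<le> q * c"
    using pos by (intro mult_le_mono2) simp
  with pos have "q + 1 \<le> m + q * c" by linarith
  then have len': "length vs = e + (q + 1)"
    by (simp add: e_def len)
  define as :: "complex list" where
    "as = replicate e 0 @ replicate (q - 1) (- of_nat c) @
      [complex_of_real ((t + s) / 2), complex_of_real ((t - s) / 2)]"
  have rad: "t\<^sup>2 + 4 * real q * real c * real m \<ge> 0" by simp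
  have quad: "(x - complex_of_real ((t + s) / 2)) * (x - complex_of_real ((t - s) / 2)) =
      x\<^sup>2 - (of_nat q - 1) * of_nat c * x - of_nat q * of_nat c * of_nat m" for x
  proof -
    have "(x - complex_of_real ((t + s) / 2)) * (x - complex_of_real ((t - s) / 2)) =
        x\<^sup>2 - complex_of_real t * x + complex_of_real ((t\<^sup>2 - s\<^sup>2) / 4)"
      by (simp add: field_simps power2_eq_square)
    also have "(t\<^sup>2 - s\<^sup>2) / 4 = - (real q * real c * real m)"
      using rad by (simp add: s_def)
    finally show ?thesis by (simp add: t_def)
  qed
  have "char_poly ?A = (\<Prod>a\<leftarrow>as. [:- a, 1:])"
  \<comment> \<open>The excluded points are the zeros of the denominators \<open>x\<close>,
    \<open>x + m\<close> and \<open>x + c\<close>.\<close>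
  proof (rule poly_eqI_cofinite[of "{0, - of_nat m, - of_nat c}"])
    fix x :: complex assume "x \<notin> {0, - of_nat m, - of_nat c}"
    then have x: "x \<noteq> 0" "x + of_nat m \<noteq> 0" "x + of_nat c \<noteq> 0"
      by (auto simp: add_eq_0_iff2 add_eq_0_iff)
    let ?d = "\<lambda>l. of_nat (card {v \<in> set vs. f v = l}) :: complex"
    have d: "?d 0 = of_nat m" "\<And>l. l < q \<Longrightarrow> ?d (Suc l) = of_nat c"
      using part0 parts vs by auto
    have "x + ?d l \<noteq> 0" if "l < Suc q" for l
      using that d x by (cases l) auto
    then have "poly (char_poly ?A) x =
        x ^ length vs * (\<Prod>l<Suc q. (x + ?d l) / x) * (1 - (\<Sum>l<Suc q. ?d l / (x + ?d l)))"
      using vs colour adj x by (intro poly_char_poly_multipartite) (auto simp: less_Suc_eq_le)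
    also have "(\<Prod>l<Suc q. (x + ?d l) / x) = (x + of_nat m) / x * ((x + of_nat c) / x) ^ q"
      using d by (simp add: prod.lessThan_Suc_shift del: prod.lessThan_Suc)
    also have "(\<Sum>l<Suc q. ?d l / (x + ?d l)) =
        of_nat m / (x + of_nat m) + of_nat q * (of_nat c / (x + of_nat c))"
      using d by (simp add: sum.lessThan_Suc_shift del: sum.lessThan_Suc)
    also have "x ^ length vs * ((x + of_nat m) / x * ((x + of_nat c) / x) ^ q) *
        (1 - (of_nat m / (x + of_nat m) + of_nat q * (of_nat c / (x + of_nat c)))) =
        x ^ e * (x + of_nat c) ^ (q - 1) *
        (x\<^sup>2 - (of_nat q - 1) * of_nat c * x - of_nat q * of_nat c * of_nat m)"
    proof -
      \<comment> \<open>One factor \<open>x + c\<close> is split off the power so that, with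
        \<open>x + m\<close>, it clears the denominators of the bracket; what remains is the
        quadratic.\<close>
      have "x ^ length vs * ((x + of_nat m) / x * ((x + of_nat c) / x) ^ q) =
          x ^ e * (x + of_nat c) ^ (q - 1) * ((x + of_nat m) * (x + of_nat c))"
        using x pos(3) by (simp add: len' power_add power_divide power_eq_if[of "x + of_nat c" q])
      moreover have "(x + of_nat m) * (x + of_nat c) *
          (1 - (of_nat m / (x + of_nat m) + of_nat q * (of_nat c / (x + of_nat c)))) =
          x\<^sup>2 - (of_nat q - 1) * of_nat c * x - of_nat q * of_nat c * of_nat m"
        using x by (simp add: divide_simps) (simp add: algebra_simps power2_eq_square)
      ultimately show ?thesis by (simp only: mult.assoc)
    qed
    also have "\<dots> = (\<Prod>a\<leftarrow>as. x - a)"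
      unfolding quad[symmetric] by (simp add: as_def prod_list_replicate)
    also have "\<dots> = poly (\<Prod>a\<leftarrow>as. [:- a, 1:]) x"
      by (simp add: poly_prod_list o_def)
    finally show "poly (char_poly ?A) x = poly (\<Prod>a\<leftarrow>as. [:- a, 1:]) x" .
  qed auto
  then have "graph_energy G = (\<Sum>a\<leftarrow>as. cmod a)"
    by (subst graph_energy_eq[OF vs], intro mat_energy_factored[of _ "length vs"])
      (auto simp: adjacency_mat_def)
  also have "\<dots> = t + \<bar>t + s\<bar> / 2 + \<bar>t - s\<bar> / 2"
    using pos(3) by (simp add: as_def sum_list_replicate t_def of_nat_diff
        flip: of_real_add of_real_diff of_real_divide)
  also have "\<dots> = t + s"
  proof -
    have "t \<ge> 0" using pos by (simp add: t_def)
    moreover have "t \<le> s" unfolding s_def by (rule real_le_rsqrt) simp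
    ultimately show ?thesis by (simp add: field_simps)
  qed
  finally show ?thesis by (simp add: s_def t_def)
qed

section \<open>Commutation and the centre in the dihedral group\<close>

text \<open>The class is parametrised by \<open>r + t * q\<close> with \<open>0 \<le> t < c\<close>.
  It serves to count both the centre and the commuting classes of reflections.\<close>

lemma card_residue_class:
  fixes c q :: nat and r :: int
  assumes "0 \<le> r" "r < int q"
  shows "card {i \<in> {0..<int (c * q)}. i mod int q = r} = c"
proof -
  have "{i \<in> {0..<int (c * q)}. i mod int q = r} = (\<lambda>t. r + t * int q) ` {0..<int c}"
  proof (intro equalityI subsetI)
    fix i assume "i \<in> {i \<in> {0..<int (c * q)}. i mod int q = r}"
    then have i: "0 \<le> i" "i < int c * int q" "i mod int q = r" by auto
    then have eq: "i = r + (i div int q) * int q" by (metis mod_mult_div_eq mult.commute)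
    have "0 \<le> i div int q" using i assms by (simp add: pos_imp_zdiv_nonneg_iff)
    moreover have "(i div int q) * int q < int c * int q"
      using eq i assms by linarith
    then have "i div int q < int c"
      by (rule mult_right_less_imp_less) simp
    ultimately show "i \<in> (\<lambda>t. r + t * int q) ` {0..<int c}" using eq by auto
  next
    fix i assume "i \<in> (\<lambda>t. r + t * int q) ` {0..<int c}"
    then obtain t where t: "0 \<le> t" "t + 1 \<le> int c" "i = r + t * int q" by auto
    then have "(t + 1) * int q \<le> int c * int q" by (intro mult_right_mono) auto
    with t assms show "i \<in> {i \<in> {0..<int (c * q)}. i mod int q = r}"
      by (auto simp: algebra_simps)
  qed
  moreover have "inj_on (\<lambda>t. r + t * int q) {0..<int c}"
    using assms by (auto simp: inj_on_def)
  ultimately show ?thesis by (simp add: card_image)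
qed

text \<open>Both products carry the same reflection flag, so only the rotation exponents are
  compared modulo \<open>n\<close>. Up to sign they differ by 0 for two rotations, by twice the
  rotation exponent in the mixed case, and by \<open>2 * (i - j)\<close> for two
  reflections.\<close>

lemma dihedral_commute_iff:
  "(i, a) \<otimes>\<^bsub>dihedral_group n\<^esub> (j, b) = (j, b) \<otimes>\<^bsub>dihedral_group n\<^esub> (i, a) \<longleftrightarrow>
    int n dvd 2 * (if a then if b then i - j else j else if b then i else 0)"
proof -
  have "int n dvd (i - j) - (i + j) \<longleftrightarrow> int n dvd 2 * j"
    using dvd_minus_iff[of "int n" "2 * j"] by simp
  then show ?thesis
    by (cases a; cases b) (simp_all add: dihedral_group_def mod_eq_dvd_iff algebra_simps)
qed

text \<open>Testing against two elements suffices: the rotation \<open>(1, False)\<close> excludes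
  reflections, because \<open>n \<ge> 3\<close> does not divide 2, and the reflection
  \<open>(0, True)\<close> forces \<open>n\<close> to divide \<open>2 * i\<close>.\<close>

lemma group_center_dihedral:
  assumes "n \<ge> 3"
  shows "group_center (dihedral_group n) = {i \<in> {0..<int n}. int n dvd 2 * i} \<times> {False}"
proof -
  let ?D = "dihedral_group n"
  have carr: "x \<in> carrier ?D \<longleftrightarrow> fst x \<in> {0..<int n}" for x
    by (cases x) (simp add: dihedral_group_def)
  have "(i, a) \<in> group_center ?D \<longleftrightarrow> i \<in> {0..<int n} \<and> int n dvd 2 * i \<and> \<not> a" for i a
  proof
    assume "(i, a) \<in> group_center ?D"
    then have i: "i \<in> {0..<int n}"
      and comm: "\<And>y. y \<in> carrier ?D \<Longrightarrow> (i, a) \<otimes>\<^bsub>?D\<^esub> y = y \<otimes>\<^bsub>?D\<^esub> (i, a)"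
      by (auto simp: group_center_def carr)
    have "\<not> int n dvd 2"
      using assms zdvd_imp_le[of "int n" 2] by auto
    with comm[of "(1, False)"] assms have "\<not> a"
      unfolding dihedral_commute_iff carr by (cases a) auto
    moreover have "int n dvd 2 * i"
      using comm[of "(0, True)"] \<open>\<not> a\<close> assms unfolding dihedral_commute_iff carr by auto
    ultimately show "i \<in> {0..<int n} \<and> int n dvd 2 * i \<and> \<not> a"
      using i by blast
  next
    assume "i \<in> {0..<int n} \<and> int n dvd 2 * i \<and> \<not> a"
    then show "(i, a) \<in> group_center ?D"
      by (auto simp: group_center_def carr dihedral_commute_iff)
  qed
  then show ?thesis by auto
qed

section \<open>The commuting classes of the dihedral group and its energy\<close>

theorem corollary2p2:
  fixes n :: nat
  assumes "n \<ge> 3"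
  shows "graph_energy (non_commuting_graph (dihedral_group n)) =
    (if even n then (real n - 2) + sqrt (5 * (real n)^2 - 12 * real n + 4)
     else (real n - 1) + sqrt (5 * (real n)^2 - 6 * real n + 1))"
proof -
  let ?G = "non_commuting_graph (dihedral_group n)"
  define c :: nat where "c = (if even n then 2 else 1)"
  define q where "q = n div c"
  have n: "n = c * q" and c: "0 < c" "c < n"
    using assms by (auto simp: q_def c_def)
  then have q: "0 < q" by (cases q) auto
  \<comment> \<open>This turns every commutation condition into a congruence modulo
    \<open>q\<close>, uniformly in the parity of \<open>n\<close>.\<close>
  have dvd2: "int n dvd 2 * i \<longleftrightarrow> int q dvd i" for i
  proof (cases "even n")
    case True
    then have "int n = 2 * int q" by (auto simp: q_def c_def)
    then show ?thesis by simp
  next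
    case False
    then have "coprime (int n) 2" by simp
    with False show ?thesis by (simp add: q_def c_def coprime_dvd_mult_right_iff)
  qed
  \<comment> \<open>Colour 0 is for rotations. Reflections commute exactly when their exponents
    agree modulo \<open>q\<close>, and the \<open>Suc\<close> keeps their colours apart from
    0.\<close>
  define f :: "int \<times> bool \<Rightarrow> nat" where
    "f = (\<lambda>(i, a). if a then Suc (nat (i mod int q)) else 0)"
  define R where "R = {i \<in> {0..<int n}. int q dvd i}"
  have verts: "pverts ?G = ({0..<int n} - R) \<times> {False} \<union> {0..<int n} \<times> {True}"
  proof -
    have "carrier (dihedral_group n) = {0..<int n} \<times> UNIV"
      by (simp add: dihedral_group_def)
    then show ?thesis
      by (auto simp: non_commuting_graph_def group_center_dihedral[OF assms] dvd2 R_def)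
  qed
  have "graph_energy ?G = (real q - 1) * real c +
      sqrt (((real q - 1) * real c)\<^sup>2 + 4 * real q * real c * real (n - c))"
  proof (rule graph_energy_multipartite[where f = f])
    show "finite (pverts ?G)" by (simp add: verts)
    show "f v \<le> q" if "v \<in> pverts ?G" for v
      using q by (cases v) (simp add: f_def Suc_le_eq nat_less_iff)
    show "(u, v) \<in> parcs ?G \<longleftrightarrow> f u \<noteq> f v" if "u \<in> pverts ?G" "v \<in> pverts ?G" for u v
    proof -
      obtain i a j b where uv: "u = (i, a)" "v = (j, b)" by (cases u; cases v)
      have "(u, v) \<in> parcs ?G \<longleftrightarrow>
          u \<otimes>\<^bsub>dihedral_group n\<^esub> v \<noteq> v \<otimes>\<^bsub>dihedral_group n\<^esub> u"
        using that by (auto simp: non_commuting_graph_def)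
      also have "\<dots> \<longleftrightarrow> f u \<noteq> f v"
        using that q unfolding verts R_def
        by (auto simp: uv dihedral_commute_iff dvd2 f_def mod_eq_dvd_iff eq_nat_nat_iff)
      finally show ?thesis .
    qed
    have "card R = c"
      using card_residue_class[of 0 q c] q by (simp add: R_def n dvd_eq_mod_eq_0)
    moreover have "R \<subseteq> {0..<int n}"
      by (auto simp: R_def)
    ultimately have "card ({0..<int n} - R) = n - c"
      using finite_subset[of R "{0..<int n}"] by (simp add: card_Diff_subset)
    moreover have "{v \<in> pverts ?G. f v = 0} = ({0..<int n} - R) \<times> {False}"
      by (auto simp: verts f_def)
    ultimately show "card {v \<in> pverts ?G. f v = 0} = n - c"
      by (simp add: card_cartesian_product)
    show "card {v \<in> pverts ?G. f v = Suc l} = c" if "l < q" for l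
    proof -
      have "{v \<in> pverts ?G. f v = Suc l} = {i \<in> {0..<int n}. i mod int q = int l} \<times> {True}"
        using q by (auto simp: verts f_def nat_eq_iff split: if_splits)
      then show ?thesis
        using that card_residue_class[of "int l" q c, folded n] by (simp add: card_cartesian_product)
    qed
  qed (use c q in auto)
  also have "(real q - 1) * real c = real n - real c"
    by (simp add: n algebra_simps)
  also have "4 * real q * real c * real (n - c) = 4 * real n * (real n - real c)"
    using c by (simp add: of_nat_diff) (simp add: n)
  \<comment> \<open>The radicand is
    \<open>(n - c)^2 + 4 * n * (n - c) = 5 * n^2 - 6 * c * n + c^2\<close>, to be read with
    \<open>c = 2\<close> or \<open>c = 1\<close>.\<close>
  finally show ?thesis
    by (cases "even n") (simp_all add: c_def algebra_simps power2_eq_square)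
qed

end
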